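(* Let $p$ be a prime, $n\ge 1$ an integer, and let $$A(n,p) = \left\{ V(a,b,c) = \begin{bmatrix} 1 & 0 & 0\\ a & 1 & 0\\ b & c & 1\end{bmatrix} : a,b,c\in GF(p^n)\right\}$$ be the Hanaki group (under matrix multiplication). Then $$\mathrm{Spec}(\Gamma_{nc}(A(n,p))) = \left\{ 0^{p^{3n}-2p^n-1},\ (-(p^{2n}-p^n))^{p^n},\ (p^n(p^{2n}-p^n))^1\right\}$$ and $$E(\Gamma_{nc}(A(n,p))) = 2p^{2n}(p^n-1).$$ The same holds for any group $G$ isomorphic to $A(n,p)$.
   Context: For a finite non-abelian group $G$ with center $Z(G)$, the non-commuting graph $\Gamma_{nc}(G)$ is the simple undirected graph with vertex set $G\setminus Z(G)$, in which two vertices $x,y$ are adjacent if and only if $xy \ne yx$. $\mathrm{Spec}(\mathcal{G}) = \{\lambda_1^{k_1},\dots,\lambda_r^{k_r}\}$ means that the eigenvalues of the adjacency matrix of the graph $\mathcal{G}$ are $\lambda_1,\dots,\lambda_r$ with multiplicities $k_1,\dots,k_r$ respectively. The energy $E(\mathcal{G})$ is the sum of the absolute values of these eigenvalues, counted with multiplicity. *)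

theory Defs
  imports
    "HOL-Algebra.Coset"
    "HOL-Combinatorics.List_Permutation"
    "Jordan_Normal_Form.Char_Poly"
    "Graph_Theory.Pair_Digraph"
begin

section \<open>The non-commuting graph\<close>

definition group_center :: "('a, 'b) monoid_scheme \<Rightarrow> 'a set" where
  "group_center G = {z \<in> carrier G. \<forall>x \<in> carrier G. z \<otimes>\<^bsub>G\<^esub> x = x \<otimes>\<^bsub>G\<^esub> z}"

text \<open>Simple undirected graphs are symmetric loop-free digraphs without parallel arcs, that is
  instances of the locale \<^locale>\<open>pair_graph\<close>; see \<open>pair_graph_noncommuting_graph\<close> below.\<close>

definition noncommuting_graph :: "('a, 'b) monoid_scheme \<Rightarrow> 'a pair_pre_digraph" where
  "noncommuting_graph G =
    \<lparr> pverts = carrier G - group_center G,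
      parcs = {(x, y). x \<in> carrier G - group_center G \<and> y \<in> carrier G - group_center G \<and>
                       x \<otimes>\<^bsub>G\<^esub> y \<noteq> y \<otimes>\<^bsub>G\<^esub> x} \<rparr>"

lemma pair_graph_noncommuting_graph:
  assumes "finite (carrier G)"
  shows "pair_graph (noncommuting_graph G)"
proof -
  have "finite (parcs (noncommuting_graph G))"
    by (rule finite_subset[of _ "carrier G \<times> carrier G"])
       (use assms in \<open>auto simp: noncommuting_graph_def\<close>)
  then show ?thesis
    using assms
    by unfold_locales (auto simp: noncommuting_graph_def symmetric_def sym_def)
qed


section \<open>Spectrum and energy of a finite graph\<close>

definition adjacency_mat :: "'a pair_pre_digraph \<Rightarrow> 'a list \<Rightarrow> real mat" where
  "adjacency_mat H vs = mat (length vs) (length vs)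
     (\<lambda>(i, j). if (vs ! i, vs ! j) \<in> parcs H then 1 else 0)"

text \<open>The spectrum is the multiset of eigenvalues of the adjacency matrix, with algebraic
  multiplicity. For an undirected graph the matrix is real symmetric, so that all its complex
  eigenvalues are real and algebraic and geometric multiplicities agree. The choice of the
  enumeration of the vertices is immaterial by \<open>graph_spec_eq\<close> below.\<close>

definition graph_spec :: "'a pair_pre_digraph \<Rightarrow> real multiset" where
  "graph_spec H =
     proots (char_poly (adjacency_mat H (SOME vs. distinct vs \<and> set vs = pverts H)))"

definition graph_energy :: "'a pair_pre_digraph \<Rightarrow> real" where
  "graph_energy H = (\<Sum>x\<in>#graph_spec H. \<bar>x\<bar>)"

lemma char_poly_adjacency_mat_permute:
  assumes p: "p permutes {..<length vs}"
  shows "char_poly (adjacency_mat H (permute_list p vs)) = char_poly (adjacency_mat H vs)"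
proof -
  define n where "n = length vs"
  have p': "p permutes {0..<n}" using p by (simp add: n_def lessThan_atLeast0)
  have lt: "p i < n" if "i < n" for i using permutes_in_image[OF p', of i] that by auto
  have inj: "p i = p j \<longleftrightarrow> i = j" for i j using permutes_inj[OF p'] by (auto dest: injD)
  define C where "C = char_poly_matrix (adjacency_mat H vs)"
  define D where "D = mat n n (\<lambda>(i, j). C $$ (p i, j))"
  have C: "C \<in> carrier_mat n n" by (simp add: C_def char_poly_matrix_def adjacency_mat_def n_def)
  have D: "D \<in> carrier_mat n n" by (simp add: D_def)
  have "char_poly_matrix (adjacency_mat H (permute_list p vs)) =
      transpose_mat (mat n n (\<lambda>(i, j). transpose_mat D $$ (p i, j)))"
    by (rule eq_matI)
       (auto simp: C_def D_def char_poly_matrix_def adjacency_mat_def n_def[symmetric] lt inj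
         permute_list_nth[OF p])
  then have "char_poly (adjacency_mat H (permute_list p vs)) =
      det (mat n n (\<lambda>(i, j). transpose_mat D $$ (p i, j)))"
    unfolding char_poly_def by (simp add: det_transpose[of _ n])
  also have "\<dots> = signof p * det (transpose_mat D)"
    using D by (intro det_permute_rows[OF _ p']) auto
  also have "det (transpose_mat D) = det D" by (rule det_transpose[OF D])
  also have "det D = signof p * det C"
    unfolding D_def by (rule det_permute_rows[OF C p'])
  also have "signof p * (signof p * det C) = det C"
    by (simp add: sign_def)
  finally show ?thesis by (simp add: C_def char_poly_def)
qed

lemma graph_spec_eq:
  assumes vs: "distinct vs" "set vs = pverts H"
  shows "graph_spec H = proots (char_poly (adjacency_mat H vs))"
proof -
  define ws where "ws = (SOME ws. distinct ws \<and> set ws = pverts H)"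
  have "distinct ws \<and> set ws = pverts H"
    unfolding ws_def by (rule someI[of _ vs]) (use vs in simp)
  then have "mset ws = mset vs"
    using vs set_eq_iff_mset_eq_distinct by metis
  then obtain p where "p permutes {..<length vs}" "permute_list p vs = ws"
    by (rule mset_eq_permutation)
  then show ?thesis
    using char_poly_adjacency_mat_permute[of p vs H] by (simp add: graph_spec_def ws_def)
qed


section \<open>The Hanaki group\<close>

definition hanaki_mat :: "'a :: field \<Rightarrow> 'a \<Rightarrow> 'a \<Rightarrow> 'a mat" where
  "hanaki_mat a b c = mat_of_rows_list 3
     [[1, 0, 0],
      [a, 1, 0],
      [b, c, 1]]"

text \<open>The parameters $n$ and $p$ enter through the type \<open>'a\<close>: the group $A(n,p)$ is obtained
  when \<open>'a\<close> is a field with $p^n$ elements, and such a field is unique up to isomorphism.\<close>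

definition hanaki_group :: "'a :: field mat monoid" where
  "hanaki_group =
    \<lparr> carrier = {hanaki_mat a b c | a b c. True}, monoid.mult = (*), one = 1\<^sub>m 3 \<rparr>"

lemma hanaki_mat_carrier [simp]: "hanaki_mat a b c \<in> carrier_mat 3 3"
  by (rule carrier_matI) (simp_all add: hanaki_mat_def mat_of_rows_list_def)

lemma hanaki_mat_index:
  "dim_row (hanaki_mat a b c) = 3" "dim_col (hanaki_mat a b c) = 3"
  "hanaki_mat a b c $$ (0, 0) = 1" "hanaki_mat a b c $$ (0, 1) = 0" "hanaki_mat a b c $$ (0, 2) = 0"
  "hanaki_mat a b c $$ (1, 0) = a" "hanaki_mat a b c $$ (1, 1) = 1" "hanaki_mat a b c $$ (1, 2) = 0"
  "hanaki_mat a b c $$ (2, 0) = b" "hanaki_mat a b c $$ (2, 1) = c" "hanaki_mat a b c $$ (2, 2) = 1"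
  by (simp_all add: hanaki_mat_def mat_of_rows_list_def)

lemma eq_hanaki_matI:
  assumes "A \<in> carrier_mat 3 3" "B \<in> carrier_mat 3 3"
    and "\<And>i j. i \<in> {0, 1, 2} \<Longrightarrow> j \<in> {0, 1, 2} \<Longrightarrow> A $$ (i, j) = B $$ (i, j)"
  shows "A = B"
proof (rule eq_matI)
  fix i j assume "i < dim_row B" "j < dim_col B"
  then have "i \<in> {0, 1, 2}" "j \<in> {0, 1, 2}" using assms(2) by auto
  then show "A $$ (i, j) = B $$ (i, j)" by (rule assms(3))
qed (use assms in auto)

lemma hanaki_mat_mult:
  "hanaki_mat a b c * hanaki_mat a' b' c' = hanaki_mat (a + a') (b + c * a' + b') (c + c')"
proof (rule eq_hanaki_matI)
  fix i j :: nat assume ij: "i \<in> {0, 1, 2}" "j \<in> {0, 1, 2}"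
  have range: "{0..<3 :: nat} = {0, 1, 2}" by auto
  have "i < 3" "j < 3" using ij by auto
  then have "(hanaki_mat a b c * hanaki_mat a' b' c') $$ (i, j) =
      (\<Sum>k\<in>{0, 1, 2}. hanaki_mat a b c $$ (i, k) * hanaki_mat a' b' c' $$ (k, j))"
    by (simp add: scalar_prod_def hanaki_mat_index(1,2) range del: One_nat_def)
  also have "\<dots> = hanaki_mat (a + a') (b + c * a' + b') (c + c') $$ (i, j)"
    using ij by (elim insertE emptyE) (simp_all add: hanaki_mat_index del: One_nat_def)
  finally show "(hanaki_mat a b c * hanaki_mat a' b' c') $$ (i, j) =
      hanaki_mat (a + a') (b + c * a' + b') (c + c') $$ (i, j)" .
qed (auto intro!: mult_carrier_mat[where n = 3])

lemma hanaki_mat_one: "1\<^sub>m 3 = hanaki_mat 0 0 0"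
proof (rule eq_hanaki_matI)
  fix i j :: nat assume "i \<in> {0, 1, 2}" "j \<in> {0, 1, 2}"
  then show "1\<^sub>m 3 $$ (i, j) = hanaki_mat 0 0 0 $$ (i, j)"
    by (elim insertE emptyE) (simp_all add: hanaki_mat_index del: One_nat_def)
qed auto

lemma group_hanaki_group: "group hanaki_group"
proof (rule groupI)
  fix x :: "'a mat" assume "x \<in> carrier hanaki_group"
  then obtain a b c where x: "x = hanaki_mat a b c" by (auto simp: hanaki_group_def)
  have "hanaki_mat (- a) (c * a - b) (- c) \<otimes>\<^bsub>hanaki_group\<^esub> x = \<one>\<^bsub>hanaki_group\<^esub>"
    by (simp add: x hanaki_group_def hanaki_mat_mult hanaki_mat_one)
  then show "\<exists>y\<in>carrier hanaki_group. y \<otimes>\<^bsub>hanaki_group\<^esub> x = \<one>\<^bsub>hanaki_group\<^esub>"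
    by (auto simp: hanaki_group_def)
next
  fix x y z :: "'a mat"
  assume "x \<in> carrier hanaki_group" "y \<in> carrier hanaki_group" "z \<in> carrier hanaki_group"
  then show "x \<otimes>\<^bsub>hanaki_group\<^esub> y \<otimes>\<^bsub>hanaki_group\<^esub> z =
      x \<otimes>\<^bsub>hanaki_group\<^esub> (y \<otimes>\<^bsub>hanaki_group\<^esub> z)"
    by (auto simp: hanaki_group_def hanaki_mat_mult algebra_simps)
next
  fix x y :: "'a mat"
  assume "x \<in> carrier hanaki_group" "y \<in> carrier hanaki_group"
  then obtain a b c a' b' c' where "x = hanaki_mat a b c" "y = hanaki_mat a' b' c'"
    by (auto simp: hanaki_group_def)
  then show "x \<otimes>\<^bsub>hanaki_group\<^esub> y \<in> carrier hanaki_group"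
    unfolding hanaki_group_def by (simp add: hanaki_mat_mult) blast
qed (auto simp: hanaki_group_def hanaki_mat_mult hanaki_mat_one)

end

theory Submission
  imports Defs
begin

text \<open>Write $q = p^n$. Two matrices $V(a,b,c)$ and $V(a',b',c')$ commute iff $c a' = c' a$. So the
  center is given by $a = c = 0$, and two non-central elements commute iff $(a : c)$ and
  $(a' : c')$ are the same point of the projective line over $GF(q)$. Hence the non-commuting graph
  is complete multipartite: its $q + 1$ parts are the fibres of the map $V(a,b,c) \mapsto (a : c)$,
  and each fibre has $m = q (q - 1)$ elements, namely $q - 1$ choices for $(a, c)$ on a fixed line
  and $q$ choices for $b$. This is \<open>hanaki_commute_iff_slope\<close> and \<open>card_hanaki_slope\<close>. An isomorphism
  preserves commuting and carries the map to the projective line over to any group $G$ isomorphic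
  to $A(n,p)$; the group $A(n,p)$ itself is the case of the identity.

  It remains to find the spectrum of a complete multipartite graph with $k$ parts of size $m$. With
  the vertex-part incidence matrix $U$, its adjacency matrix is $U (J_k - I_k) U^T$. The
  characteristic polynomials of $X Y$ and $Y X$ agree up to a power of the variable
  (\<open>det_smult_one_minus_mult_swap\<close>), so only the $k \times k$ matrix
  $(J_k - I_k) U^T U = m (J_k - I_k)$ matters. As $J_k$ has rank one, the same swap reduces its
  determinant to a $1 \times 1$ one, which gives the eigenvalues $-m$ ($k - 1$ times) and
  $(k - 1) m$; all others are $0$.\<close>

section \<open>Determinants of low-rank perturbations of a scalar matrix\<close>

text \<open>Both sides are read off from the block matrix $M$ with rows $(t I_n, X)$ and $(Y, I_k)$: it
  becomes block upper triangular when $Y$ is cleared, either by column operations (multiplication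
  by $L$ on the right) or by row operations (multiplication by $R$ on the left). The latter first
  scale the lower rows by $t$, so that no division by $t$ occurs.\<close>

lemma det_smult_one_minus_mult_swap:
  fixes t :: "'a :: idom"
  assumes X: "X \<in> carrier_mat n k" and Y: "Y \<in> carrier_mat k n"
  shows "t ^ k * det (t \<cdot>\<^sub>m 1\<^sub>m n - X * Y) = t ^ n * det (t \<cdot>\<^sub>m 1\<^sub>m k - Y * X)"
proof -
  define M where "M = four_block_mat (t \<cdot>\<^sub>m 1\<^sub>m n) X Y (1\<^sub>m k)"
  define L where "L = four_block_mat (1\<^sub>m n) (0\<^sub>m n k) (- Y) (1\<^sub>m k)"
  define R where "R = four_block_mat (1\<^sub>m n) (0\<^sub>m n k) (- Y) (t \<cdot>\<^sub>m 1\<^sub>m k)"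
  have M: "M \<in> carrier_mat (n + k) (n + k)" and L: "L \<in> carrier_mat (n + k) (n + k)"
    and R: "R \<in> carrier_mat (n + k) (n + k)"
    by (auto simp: M_def L_def R_def)
  have YX: "Y * X \<in> carrier_mat k k"
    using X Y by auto
  have "M * L = four_block_mat (t \<cdot>\<^sub>m 1\<^sub>m n * 1\<^sub>m n + X * - Y) (t \<cdot>\<^sub>m 1\<^sub>m n * 0\<^sub>m n k + X * 1\<^sub>m k)
      (Y * 1\<^sub>m n + 1\<^sub>m k * - Y) (Y * 0\<^sub>m n k + 1\<^sub>m k * 1\<^sub>m k)"
    unfolding M_def L_def by (rule mult_four_block_mat) (use X Y in auto)
  also have "\<dots> = four_block_mat (t \<cdot>\<^sub>m 1\<^sub>m n - X * Y) X (0\<^sub>m k n) (1\<^sub>m k)"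
    using X Y by (intro cong_four_block_mat eq_matI) auto
  finally have "det (M * L) = det (t \<cdot>\<^sub>m 1\<^sub>m n - X * Y) * det (1\<^sub>m k)"
    using X Y by (subst det_four_block_mat_lower_left_zero[symmetric]) auto
  moreover have "det L = 1"
    unfolding L_def by (subst det_four_block_mat_upper_right_zero) (use Y in auto)
  ultimately have 1: "det M = det (t \<cdot>\<^sub>m 1\<^sub>m n - X * Y)"
    by (simp add: det_mult[OF M L])
  have "R * M = four_block_mat (1\<^sub>m n * (t \<cdot>\<^sub>m 1\<^sub>m n) + 0\<^sub>m n k * Y) (1\<^sub>m n * X + 0\<^sub>m n k * 1\<^sub>m k)
      (- Y * (t \<cdot>\<^sub>m 1\<^sub>m n) + t \<cdot>\<^sub>m 1\<^sub>m k * Y) (- Y * X + t \<cdot>\<^sub>m 1\<^sub>m k * 1\<^sub>m k)"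
    unfolding M_def R_def by (rule mult_four_block_mat) (use X Y in auto)
  also have "\<dots> = four_block_mat (t \<cdot>\<^sub>m 1\<^sub>m n) X (0\<^sub>m k n) (t \<cdot>\<^sub>m 1\<^sub>m k - Y * X)"
    using X Y by (intro cong_four_block_mat eq_matI) auto
  finally have "det (R * M) = det (t \<cdot>\<^sub>m 1\<^sub>m n) * det (t \<cdot>\<^sub>m 1\<^sub>m k - Y * X)"
    using X Y YX by (subst det_four_block_mat_lower_left_zero[symmetric]) auto
  moreover have "det R = t ^ k"
    unfolding R_def by (subst det_four_block_mat_upper_right_zero) (use Y in auto)
  ultimately have "t ^ k * det M = t ^ n * det (t \<cdot>\<^sub>m 1\<^sub>m k - Y * X)"
    by (simp add: det_mult[OF R M])
  with 1 show ?thesis by simp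
qed

text \<open>The matrix is $t I_k - P Q$ with a column $P$ and a row $Q$, so the swap of $P$ and $Q$ leaves
  a $1 \times 1$ determinant, and a factor $t$ can be cancelled.\<close>

lemma det_scalar_minus_constant_mat:
  fixes t s :: "'a :: idom"
  assumes "t \<noteq> 0" "k > 0"
  shows "det (mat k k (\<lambda>(i, j). (if i = j then t else 0) - s)) = t ^ (k - 1) * (t - of_nat k * s)"
proof -
  define P where "P = mat k 1 (\<lambda>_. s)"
  define Q where "Q = mat 1 k (\<lambda>_. 1 :: 'a)"
  have "t \<cdot>\<^sub>m 1\<^sub>m k - P * Q = mat k k (\<lambda>(i, j). (if i = j then t else 0) - s)"
    by (rule eq_matI) (auto simp: P_def Q_def scalar_prod_def)
  moreover have "det (t \<cdot>\<^sub>m 1\<^sub>m 1 - Q * P) = t - of_nat k * s"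
    by (subst det_single) (auto simp: P_def Q_def scalar_prod_def)
  moreover have "t ^ 1 * det (t \<cdot>\<^sub>m 1\<^sub>m k - P * Q) = t ^ k * det (t \<cdot>\<^sub>m 1\<^sub>m 1 - Q * P)"
    by (rule det_smult_one_minus_mult_swap) (auto simp: P_def Q_def)
  ultimately have "t * det (mat k k (\<lambda>(i, j). (if i = j then t else 0) - s))
      = t * (t ^ (k - 1) * (t - of_nat k * s))"
    using \<open>k > 0\<close> by (cases k) auto
  with \<open>t \<noteq> 0\<close> show ?thesis by (simp only: mult_cancel_left) simp
qed

section \<open>The spectrum of a complete multipartite graph\<close>

text \<open>The map $f$ names the part of each vertex, so that the vertices need not be listed part by
  part. The adjacency matrix factors as $X Y$ through the $k$-dimensional space of parts, where
  $Y X$ has the entry $m$ off the diagonal and $0$ on it.\<close>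

lemma char_poly_complete_multipartite:
  fixes H :: "'v pair_pre_digraph" and f :: "'v \<Rightarrow> 'c"
  assumes vs: "distinct vs" "vs \<noteq> []"
    and adj: "\<And>x y. x \<in> set vs \<Longrightarrow> y \<in> set vs \<Longrightarrow> (x, y) \<in> parcs H \<longleftrightarrow> f x \<noteq> f y"
    and card_part: "\<And>c. c \<in> f ` set vs \<Longrightarrow> card {x \<in> set vs. f x = c} = m"
    and k: "k = card (f ` set vs)"
  shows "char_poly (adjacency_mat H vs) =
    [:0, 1:] ^ (k * (m - 1)) * ([:real m, 1:] ^ (k - 1) * [:- (real (k - 1) * real m), 1:])"
proof -
  define n where "n = length vs"
  obtain cs where cs: "set cs = f ` set vs" "distinct cs"
    using finite_distinct_list[of "f ` set vs"] by auto
  have len: "length cs = k" using cs k by (simp add: distinct_card[symmetric])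
  have k0: "k > 0" using vs k by (auto simp: card_gt_0_iff)
  have "n = card (set vs)" using vs by (simp add: n_def distinct_card)
  also have "\<dots> = (\<Sum>c\<in>f ` set vs. card {x \<in> set vs. f x = c})"
    using sum.image_gen[of "set vs" "\<lambda>_. 1 :: nat" f] by simp
  also have "\<dots> = k * m" using card_part k by simp
  finally have n: "n = k * m" .
  have m0: "m > 0" using n vs by (cases "m = 0") (auto simp: n_def)

  define x where "x = [:0, 1 :: real:]"
  define X where "X = mat n k (\<lambda>(i, c). if f (vs ! i) = cs ! c then 1 else 0 :: real poly)"
  define Y where "Y = mat k n (\<lambda>(c, j). if f (vs ! j) = cs ! c then 0 else 1 :: real poly)"
  have X: "X \<in> carrier_mat n k" and Y: "Y \<in> carrier_mat k n" by (auto simp: X_def Y_def)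

  have XY: "x \<cdot>\<^sub>m 1\<^sub>m n - X * Y = char_poly_matrix (adjacency_mat H vs)"
  proof (rule eq_matI)
    fix i j assume "i < dim_row (char_poly_matrix (adjacency_mat H vs))"
      "j < dim_col (char_poly_matrix (adjacency_mat H vs))"
    then have ij: "i < n" "j < n" by (auto simp: char_poly_matrix_def adjacency_mat_def n_def)
    obtain d where d: "d < k" "cs ! d = f (vs ! i)"
      using cs len ij by (metis image_eqI in_set_conv_nth n_def nth_mem)
    \<comment> \<open>Only the part containing the \<open>i\<close>-th vertex contributes to the sum over all parts.\<close>
    have "(X * Y) $$ (i, j) = (\<Sum>c = 0..<k. (if f (vs ! i) = cs ! c then 1 else 0)
        * (if f (vs ! j) = cs ! c then 0 else 1))"
      using ij by (simp add: X_def Y_def scalar_prod_def)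
    also have "\<dots> = (\<Sum>c = 0..<k. if c = d then if f (vs ! j) = f (vs ! i) then 0 else 1 else 0)"
      using cs(2) len d by (intro sum.cong) (auto simp: nth_eq_iff_index_eq)
    also have "\<dots> = (if f (vs ! j) = f (vs ! i) then 0 else 1)" using d by simp
    also have "\<dots> = (if (vs ! i, vs ! j) \<in> parcs H then 1 else 0)"
      using adj[of "vs ! i" "vs ! j"] ij by (auto simp: n_def)
    finally show "(x \<cdot>\<^sub>m 1\<^sub>m n - X * Y) $$ (i, j)
        = char_poly_matrix (adjacency_mat H vs) $$ (i, j)"
      using ij X Y
      by (simp add: char_poly_matrix_def adjacency_mat_def n_def x_def one_pCons)
  qed (use X Y in \<open>auto simp: char_poly_matrix_def adjacency_mat_def n_def\<close>)

  have YX: "x \<cdot>\<^sub>m 1\<^sub>m k - Y * X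
      = mat k k (\<lambda>(i, j). (if i = j then x + of_nat m else 0) - of_nat m)"
  proof (rule eq_matI)
    fix i j assume "i < dim_row (mat k k (\<lambda>(i, j). (if i = j then x + of_nat m else 0) - of_nat m))"
      "j < dim_col (mat k k (\<lambda>(i, j). (if i = j then x + of_nat m else 0) - of_nat m))"
    then have ij: "i < k" "j < k" by auto
    define g where "g v = (if f v = cs ! j \<and> i \<noteq> j then 1 else 0 :: real poly)" for v
    have eq: "cs ! i = cs ! j \<longleftrightarrow> i = j" using cs(2) len ij by (simp add: nth_eq_iff_index_eq)
    \<comment> \<open>The sum counts the vertices that lie in part \<open>j\<close> but not in part \<open>i\<close>.\<close>
    have "(Y * X) $$ (i, j) = (\<Sum>l = 0..<n. (if f (vs ! l) = cs ! i then 0 else 1)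
        * (if f (vs ! l) = cs ! j then 1 else 0))"
      using ij by (simp add: X_def Y_def scalar_prod_def)
    also have "\<dots> = (\<Sum>l = 0..<n. g (vs ! l))"
    proof (rule sum.cong)
      fix l assume "l \<in> {0..<n}"
      show "(if f (vs ! l) = cs ! i then 0 else 1)
          * (if f (vs ! l) = cs ! j then 1 else 0) = g (vs ! l)"
        by (cases "f (vs ! l) = cs ! j")
           (simp_all add: g_def eq[symmetric] eq_commute)
    qed simp
    also have "\<dots> = sum g (set vs)"
      using vs by (simp add: n_def sum_list_distinct_conv_sum_set[symmetric] sum_list_sum_nth)
    also have "\<dots> = (if i = j then 0 else of_nat (card {v \<in> set vs. f v = cs ! j}))"
      by (simp add: g_def sum.If_cases Int_def)
    also have "\<dots> = (if i = j then 0 else of_nat m)"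
      using card_part[of "cs ! j"] cs(1) len ij by (metis nth_mem)
    finally show "(x \<cdot>\<^sub>m 1\<^sub>m k - Y * X) $$ (i, j)
        = mat k k (\<lambda>(i, j). (if i = j then x + of_nat m else 0) - of_nat m) $$ (i, j)"
      using ij X Y by simp
  qed (use X Y in auto)

  \<comment> \<open>The determinant of the small matrix is the one above with diagonal \<open>x + m\<close> and constant \<open>m\<close>.\<close>
  have t: "x + of_nat m = [:real m, 1:]" by (simp add: x_def of_nat_poly)
  have "x ^ k * char_poly (adjacency_mat H vs) = x ^ n * det (x \<cdot>\<^sub>m 1\<^sub>m k - Y * X)"
    using det_smult_one_minus_mult_swap[OF X Y, of x] by (simp add: XY char_poly_def)
  also have "det (x \<cdot>\<^sub>m 1\<^sub>m k - Y * X) =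
      [:real m, 1:] ^ (k - 1) * ([:real m, 1:] - of_nat k * of_nat m)"
    unfolding YX t by (rule det_scalar_minus_constant_mat) (use k0 in auto)
  also have "[:real m, 1:] - of_nat k * of_nat m = [:- (real (k - 1) * real m), 1:]"
    using k0 by (simp add: of_nat_poly of_nat_diff algebra_simps)
  also have "x ^ n = x ^ k * x ^ (k * (m - 1))"
    using m0 n by (cases m) (simp_all flip: power_add)
  finally show ?thesis by (simp add: x_def)
qed

lemma graph_spec_complete_multipartite:
  fixes H :: "'v pair_pre_digraph" and f :: "'v \<Rightarrow> 'c"
  assumes fin: "finite (pverts H)" and ne: "pverts H \<noteq> {}"
    and adj: "\<And>x y. x \<in> pverts H \<Longrightarrow> y \<in> pverts H \<Longrightarrow> (x, y) \<in> parcs H \<longleftrightarrow> f x \<noteq> f y"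
    and card_part: "\<And>c. c \<in> f ` pverts H \<Longrightarrow> card {x \<in> pverts H. f x = c} = m"
    and k: "k = card (f ` pverts H)"
  shows "graph_spec H = replicate_mset (k * (m - 1)) 0 + replicate_mset (k - 1) (- real m)
    + {#real (k - 1) * real m#}"
proof -
  obtain vs where vs: "set vs = pverts H" "distinct vs"
    using finite_distinct_list[OF fin] by auto
  have "char_poly (adjacency_mat H vs) =
    [:0, 1:] ^ (k * (m - 1)) * ([:real m, 1:] ^ (k - 1) * [:- (real (k - 1) * real m), 1:])"
    by (rule char_poly_complete_multipartite[of vs H f]) (use assms vs in auto)
  then show ?thesis
    by (simp add: graph_spec_eq[OF vs(2,1)] proots_mult proots_power del: mult_pCons_right mult_pCons_left)
qed

section \<open>Commuting elements of the Hanaki group\<close>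

text \<open>This is the point $(a : c)$ of the projective line, for non-central $V(a,b,c)$: the affine
  point $c / a$, or \<open>None\<close> for the point at infinity. On central elements, where $a = c = 0$, the
  value \<open>None\<close> is meaningless.\<close>

definition hanaki_slope :: "'a :: field mat \<Rightarrow> 'a option" where
  "hanaki_slope A = (if A $$ (1, 0) = 0 then None else Some (A $$ (2, 1) / A $$ (1, 0)))"

lemma hanaki_slope_hanaki_mat:
  "hanaki_slope (hanaki_mat a b c) = (if a = 0 then None else Some (c / a))"
  by (simp only: hanaki_slope_def hanaki_mat_index)

lemma hanaki_mat_eq_iff:
  "hanaki_mat a b c = hanaki_mat a' b' c' \<longleftrightarrow> a = a' \<and> b = b' \<and> c = c'"
  by (metis hanaki_mat_index(6,9,10))

lemma hanaki_commute_iff: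
  "hanaki_mat a b c * hanaki_mat a' b' c' = hanaki_mat a' b' c' * hanaki_mat a b c
    \<longleftrightarrow> c * a' = c' * a"
  by (auto simp: hanaki_mat_mult hanaki_mat_eq_iff algebra_simps)

lemma hanaki_mult_eq [simp]: "A \<otimes>\<^bsub>hanaki_group\<^esub> B = A * B"
  by (simp add: hanaki_group_def)

text \<open>Commuting with $V(1,0,0)$ forces $c = 0$, and commuting with $V(0,0,1)$ forces $a = 0$.\<close>

lemma hanaki_mat_in_center_iff:
  "hanaki_mat a b c \<in> group_center hanaki_group \<longleftrightarrow> a = 0 \<and> c = 0"
proof
  assume "hanaki_mat a b c \<in> group_center hanaki_group"
  then have "hanaki_mat a b c * hanaki_mat a' b' c' = hanaki_mat a' b' c' * hanaki_mat a b c"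
    for a' b' c' by (auto simp: group_center_def hanaki_group_def)
  then have "c * a' = c' * a" for a' c' by (simp add: hanaki_commute_iff)
  from this[of 1 0] this[of 0 1] show "a = 0 \<and> c = 0" by auto
qed (auto simp: group_center_def hanaki_group_def hanaki_commute_iff)

lemma hanaki_noncentral:
  "carrier hanaki_group - group_center hanaki_group
    = {hanaki_mat a b c | a b c :: 'a :: field. a \<noteq> 0 \<or> c \<noteq> 0}"
proof -
  have "carrier hanaki_group = {hanaki_mat a b c | a b c :: 'a. True}"
    by (simp add: hanaki_group_def)
  then show ?thesis
    by (auto simp: hanaki_mat_in_center_iff hanaki_mat_eq_iff)
qed

lemma hanaki_commute_iff_slope:
  assumes "A \<in> carrier hanaki_group - group_center hanaki_group"
    and "B \<in> carrier hanaki_group - group_center hanaki_group"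
  shows "A * B = B * A \<longleftrightarrow> hanaki_slope A = hanaki_slope B"
  using assms unfolding hanaki_noncentral
  by (auto simp: hanaki_commute_iff hanaki_slope_hanaki_mat field_simps split: if_splits)

text \<open>A fibre is parametrized by a nonzero scalar $u$, which fixes $(a, c)$ on its line, and by an
  arbitrary $b$.\<close>

lemma card_hanaki_slope:
  fixes s :: "'a :: field option"
  assumes fin: "finite (UNIV :: 'a set)"
  shows "card {A \<in> carrier hanaki_group - group_center hanaki_group. hanaki_slope A = s}
    = card (UNIV :: 'a set) * (card (UNIV :: 'a set) - 1)"
proof -
  define h where "h = (\<lambda>(u :: 'a, b). case s of None \<Rightarrow> hanaki_mat 0 b u
    | Some r \<Rightarrow> hanaki_mat u b (r * u))"
  have "{A \<in> carrier hanaki_group - group_center hanaki_group. hanaki_slope A = s}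
      = h ` ((UNIV - {0}) \<times> UNIV)"
  proof (intro equalityI subsetI)
    fix A assume "A \<in> {A \<in> carrier hanaki_group - group_center hanaki_group. hanaki_slope A = s}"
    then obtain a b c where A: "A = hanaki_mat a b c" "a \<noteq> 0 \<or> c \<noteq> 0" "hanaki_slope A = s"
      unfolding hanaki_noncentral by blast
    show "A \<in> h ` ((UNIV - {0}) \<times> UNIV)"
    proof (cases s)
      case None
      with A show ?thesis
        by (intro image_eqI[of _ _ "(c, b)"])
           (auto simp: h_def hanaki_slope_hanaki_mat split: if_splits)
    next
      case (Some r)
      with A show ?thesis
        by (intro image_eqI[of _ _ "(a, b)"])
           (auto simp: h_def hanaki_slope_hanaki_mat split: if_splits)
    qed
  next
    fix A assume "A \<in> h ` ((UNIV - {0}) \<times> UNIV)"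
    then obtain u b where "u \<noteq> 0" "A = h (u, b)" by auto
    then show "A \<in> {A \<in> carrier hanaki_group - group_center hanaki_group. hanaki_slope A = s}"
      unfolding hanaki_noncentral
      by (cases s) (auto simp: h_def hanaki_slope_hanaki_mat hanaki_mat_eq_iff)
  qed
  moreover have "inj_on h ((UNIV - {0}) \<times> UNIV)"
    by (auto simp: inj_on_def h_def hanaki_mat_eq_iff split: option.splits)
  ultimately show ?thesis
    using fin by (simp add: card_image card_cartesian_product card_Diff_singleton)
qed

section \<open>Spectrum and energy of the non-commuting graph\<close>

text \<open>The vertices of the graph are colored by the slope of their image under an isomorphism $h$,
  which shows the graph of $G$ to be complete multipartite without transporting spectra between
  graphs.\<close>

lemma iso_hanaki_spec_energy:
  fixes G :: "('g, 'h) monoid_scheme"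
  assumes fin: "finite (UNIV :: 'a :: field set)" and q: "q = card (UNIV :: 'a set)"
    and G: "group G" and iso: "G \<cong> (hanaki_group :: 'a mat monoid)"
  shows "graph_spec (noncommuting_graph G) =
      replicate_mset (q ^ 3 - 2 * q - 1) 0 + replicate_mset q (- (real q ^ 2 - real q))
      + replicate_mset 1 (real q * (real q ^ 2 - real q))"
    and "graph_energy (noncommuting_graph G) = 2 * real q ^ 2 * (real q - 1)"
proof -
  let ?H = "hanaki_group :: 'a mat monoid"
  define W where "W = carrier ?H - group_center ?H"
  define V where "V = carrier G - group_center G"
  define \<Gamma> where "\<Gamma> = noncommuting_graph G"
  obtain h where hom: "h \<in> hom G ?H" and bij: "bij_betw h (carrier G) (carrier ?H)"
    using iso by (auto simp: is_iso_def iso_def)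
  define f where "f = hanaki_slope \<circ> h"
  interpret group G by (rule G)
  \<comment> \<open>Since \<open>0 \<noteq> 1\<close> in a field; this makes the truncated subtractions below exact.\<close>
  have q2: "q \<ge> 2"
    using card_mono[OF fin, of "{0, 1}"] q by simp

  have comm: "x \<otimes>\<^bsub>G\<^esub> y = y \<otimes>\<^bsub>G\<^esub> x \<longleftrightarrow> h x * h y = h y * h x"
    if "x \<in> carrier G" "y \<in> carrier G" for x y
  proof -
    have "x \<otimes>\<^bsub>G\<^esub> y = y \<otimes>\<^bsub>G\<^esub> x \<longleftrightarrow> h (x \<otimes>\<^bsub>G\<^esub> y) = h (y \<otimes>\<^bsub>G\<^esub> x)"
      using bij that by (auto simp: bij_betw_def dest: inj_onD)
    then show ?thesis
      using hom that by (simp add: hom_mult hanaki_group_def)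
  qed
  have hC: "h x \<in> group_center ?H \<longleftrightarrow> x \<in> group_center G" if "x \<in> carrier G" for x
  proof -
    have "h x \<in> carrier ?H" and img: "carrier ?H = h ` carrier G"
      using bij that by (auto simp: bij_betw_def)
    then have "h x \<in> group_center ?H \<longleftrightarrow> (\<forall>B \<in> carrier ?H. h x * B = B * h x)"
      by (simp add: group_center_def)
    also have "\<dots> \<longleftrightarrow> (\<forall>B \<in> h ` carrier G. h x * B = B * h x)"
      by (simp only: img)
    also have "\<dots> \<longleftrightarrow> x \<in> group_center G"
      using that by (auto simp: group_center_def comm)
    finally show ?thesis .
  qed
  have bij_VW: "bij_betw h V W"
  proof (rule bij_betw_subset[OF bij])
    have "carrier ?H = h ` carrier G" using bij by (simp add: bij_betw_def)
    then show "h ` V = W" using hC by (auto simp: V_def W_def)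
  qed (auto simp: V_def)
  have hV: "h x \<in> W" if "x \<in> V" for x
    using bij_VW that by (auto simp: bij_betw_def)

  have card_part: "card {x \<in> V. f x = s} = q * (q - 1)" for s
  proof -
    have "bij_betw h {x \<in> V. f x = s} {A \<in> W. hanaki_slope A = s}"
      by (rule bij_betw_subset[OF bij_VW])
        (use bij_VW in \<open>auto simp: f_def bij_betw_def\<close>)
    then show ?thesis
      using bij_betw_same_card card_hanaki_slope[OF fin, of s] q by (fastforce simp: W_def)
  qed
  \<comment> \<open>Every fibre has \<open>q (q - 1) > 0\<close> elements, so all \<open>q + 1\<close> slopes occur.\<close>
  have "s \<in> f ` V" for s
  proof (rule ccontr)
    assume "s \<notin> f ` V"
    then have "{x \<in> V. f x = s} = {}" by auto
    with card_part[of s] q2 show False by simp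
  qed
  then have "f ` V = UNIV" by blast
  then have card_f: "card (f ` V) = q + 1"
    using fin q by (simp add: UNIV_option_conv card_image)

  have "finite W"
  proof (rule finite_subset)
    show "W \<subseteq> (\<lambda>(a, b, c). hanaki_mat a b c) ` UNIV"
      by (auto simp: W_def hanaki_noncentral image_iff hanaki_mat_eq_iff)
    show "finite ((\<lambda>(a, b, c). hanaki_mat a b c) ` (UNIV :: ('a \<times> 'a \<times> 'a) set))"
      using fin by (simp add: finite_prod)
  qed
  then have "finite V" using bij_VW bij_betw_finite by blast
  have verts: "pverts \<Gamma> = V" by (simp add: \<Gamma>_def V_def noncommuting_graph_def)
  have "graph_spec \<Gamma> = replicate_mset ((q + 1) * (q * (q - 1) - 1)) 0
      + replicate_mset (q + 1 - 1) (- real (q * (q - 1)))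
      + {#real (q + 1 - 1) * real (q * (q - 1))#}"
  proof (rule graph_spec_complete_multipartite[where f = f])
    show "finite (pverts \<Gamma>)" "pverts \<Gamma> \<noteq> {}"
      using \<open>finite V\<close> \<open>f ` V = UNIV\<close> by (auto simp: verts)
    show "(x, y) \<in> parcs \<Gamma> \<longleftrightarrow> f x \<noteq> f y" if "x \<in> pverts \<Gamma>" "y \<in> pverts \<Gamma>" for x y
      using that hanaki_commute_iff_slope[of "h x" "h y"] hV comm
      by (auto simp: \<Gamma>_def noncommuting_graph_def f_def V_def W_def)
  qed (use card_part card_f in \<open>auto simp: verts\<close>)
  moreover have "(q + 1) * (q * (q - 1) - 1) = q ^ 3 - 2 * q - 1"
  proof -
    obtain r where r: "q = r + 2" using q2 by (metis add.commute le_Suc_ex)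
    show ?thesis by (simp add: r power3_eq_cube algebra_simps)
  qed
  moreover have "real (q * (q - 1)) = real q ^ 2 - real q"
    using q2 by (simp add: of_nat_diff power2_eq_square algebra_simps)
  ultimately show spec: "graph_spec (noncommuting_graph G) =
      replicate_mset (q ^ 3 - 2 * q - 1) 0 + replicate_mset q (- (real q ^ 2 - real q))
      + replicate_mset 1 (real q * (real q ^ 2 - real q))"
    by (simp add: \<Gamma>_def)
  have "real q ^ 2 - real q \<ge> 0"
    using q2 by (simp add: power2_eq_square)
  then have "\<bar>- (real q ^ 2 - real q)\<bar> = real q ^ 2 - real q"
    "\<bar>real q * (real q ^ 2 - real q)\<bar> = real q * (real q ^ 2 - real q)"
    by (simp_all only: abs_minus_cancel abs_of_nonneg abs_mult of_nat_0_le_iff)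
  then show "graph_energy (noncommuting_graph G) = 2 * real q ^ 2 * (real q - 1)"
    unfolding graph_energy_def spec
    by (simp add: image_replicate_mset power2_eq_square algebra_simps)
qed

theorem theorem2p4:
  fixes p n :: nat
  assumes "prime p" and "n \<ge> 1" and "card (UNIV :: 'a :: field set) = p ^ n"
  shows
    "(graph_spec (noncommuting_graph (hanaki_group :: 'a mat monoid)) =
        replicate_mset (p ^ (3 * n) - 2 * p ^ n - 1) 0
        + replicate_mset (p ^ n) (- (real p ^ (2 * n) - real p ^ n))
        + replicate_mset 1 (real p ^ n * (real p ^ (2 * n) - real p ^ n))
      \<and> graph_energy (noncommuting_graph (hanaki_group :: 'a mat monoid)) =
        2 * real p ^ (2 * n) * (real p ^ n - 1))
    \<and> (\<forall>G :: ('g, 'h) monoid_scheme.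
        group G \<and> G \<cong> (hanaki_group :: 'a mat monoid) \<longrightarrow>
          graph_spec (noncommuting_graph G) =
            replicate_mset (p ^ (3 * n) - 2 * p ^ n - 1) 0
            + replicate_mset (p ^ n) (- (real p ^ (2 * n) - real p ^ n))
            + replicate_mset 1 (real p ^ n * (real p ^ (2 * n) - real p ^ n))
          \<and> graph_energy (noncommuting_graph G) =
            2 * real p ^ (2 * n) * (real p ^ n - 1))"
proof -
  have fin: "finite (UNIV :: 'a set)"
    using assms prime_gt_0_nat[of p] by (metis card.infinite not_gr_zero power_eq_0_iff)
  have q: "p ^ n = card (UNIV :: 'a set)" using assms by simp
  have pw: "p ^ (3 * n) = (p ^ n) ^ 3" "real p ^ (2 * n) = real (p ^ n) ^ 2"
    "real p ^ n = real (p ^ n)"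
    by (simp_all add: power_mult[symmetric] mult.commute)
  note main = iso_hanaki_spec_energy[OF fin q]
  show ?thesis
    unfolding pw
    by (intro conjI allI impI; (elim conjE)?; rule main; (assumption | rule group_hanaki_group iso_refl))
qed

end
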